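(* Assume that $\frac{2N}{N+2s}<p<\frac{N}{2s}$ and $\alpha,\beta<p$. Then there exists $\gamma_1>0$ such that for any $\gamma\in(0,\gamma_1)$ there exists a solution $(k(\gamma),\ell(\gamma))$ of the algebraic system $$\begin{cases}k^{\frac{p_s^*-p}{p}}+\frac{\alpha\gamma}{p_s^*}k^{\frac{\alpha-p}{p}}\ell^{\frac{\beta}{p}}=1,\\ \ell^{\frac{p_s^*-p}{p}}+\frac{\beta\gamma}{p_s^*}\ell^{\frac{\beta-p}{p}}k^{\frac{\alpha}{p}}=1,\\ k,\ell>0,\end{cases}$$ such that $\big(k(\gamma)^{1/p}U,\ell(\gamma)^{1/p}U\big)$ is a positive solution of the system $$\begin{cases}(-\Delta_p)^s u=|u|^{p_s^*-2}u+\frac{\alpha\gamma}{p_s^*}|u|^{\alpha-2}u|v|^{\beta} & \text{in }\mathbb{R}^N,\\ (-\Delta_p)^s v=|v|^{p_s^*-2}v+\frac{\beta\gamma}{p_s^*}|v|^{\beta-2}v|u|^{\alpha} & \text{in }\mathbb{R}^N,\\ u,v\in\dot W^{s,p}(\mathbb{R}^N),\end{cases}$$ with $$\mathcal J\big(k(\gamma)^{1/p}U,\ell(\gamma)^{1/p}U\big)>\tilde A:=\inf_{(u,v)\in\tilde{\mathcal N}}\mathcal J(u,v),$$ where $U$ is a minimizer of $\mathcal S$ normalized so that $(-\Delta_p)^sU=U^{p_s^*-1}$, $U>0$ in $\mathbb{R}^N$.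
   Context: Standing assumptions: $N\ge 1$ is an integer, $0<s<1$, $1<p<\infty$, $N>sp$, $p_s^*:=\frac{Np}{N-sp}$, and $\alpha,\beta>1$ are real numbers with $\alpha+\beta=p_s^*$. $\dot W^{s,p}(\mathbb{R}^N)$ is the space of $u\in L^{p_s^*}(\mathbb{R}^N)$ with finite norm $\|u\|_{\dot W^{s,p}}:=\Big(\iint_{\mathbb{R}^{2N}}\frac{|u(x)-u(y)|^p}{|x-y|^{N+sp}}\,dx\,dy\Big)^{1/p}$, and $X:=\dot W^{s,p}(\mathbb{R}^N)\times\dot W^{s,p}(\mathbb{R}^N)$. The operator $(-\Delta_p)^s$ and solutions are understood weakly, via $\langle(-\Delta_p)^su,\phi\rangle=\iint_{\mathbb{R}^{2N}}\frac{|u(x)-u(y)|^{p-2}(u(x)-u(y))(\phi(x)-\phi(y))}{|x-y|^{N+sp}}\,dx\,dy$ tested against all $\phi\in\dot W^{s,p}(\mathbb{R}^N)$. A solution $(u,v)$ is positive if $u,v>0$. The best Sobolev constant is $\mathcal S:=\inf_{u\in\dot W^{s,p}(\mathbb{R}^N),\,u\neq0}\|u\|_{\dot W^{s,p}}^p\big/\big(\int_{\mathbb{R}^N}|u|^{p_s^*}dx\big)^{p/p_s^*}$. For given $\gamma>0$ and $(u,v)\in X$, $$\mathcal J(u,v)=\frac1p\left(\|u\|_{\dot W^{s,p}}^p+\|v\|_{\dot W^{s,p}}^p\right)-\frac1{p_s^*}\int_{\mathbb{R}^N}\left(|u|^{p_s^*}+|v|^{p_s^*}+\gamma|u|^\alpha|v|^\beta\right)dx,$$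 $$\tilde{\mathcal N}=\Big\{(u,v)\in X\setminus\{0\}:\|u\|_{\dot W^{s,p}}^p+\|v\|_{\dot W^{s,p}}^p=\int_{\mathbb{R}^N}\left(|u|^{p_s^*}+|v|^{p_s^*}+\gamma|u|^\alpha|v|^\beta\right)dx\Big\}.$$ *)

theory Defs
  imports "HOL-Analysis.Analysis"
begin

text \<open>
  \<open>\<real>\<^sup>N\<close> is \<^typ>\<open>real ^ 'n\<close> with \<open>N = CARD('n)\<close>. Elements of \<open>L\<^sup>q\<close> are represented by Lebesgue
  measurable functions, so \<open>u = 0\<close> and \<open>u > 0\<close> are understood almost everywhere. Integrals over
  \<open>\<real>\<^sup>2\<^sup>N\<close> are taken with respect to Lebesgue measure on \<^typ>\<open>(real ^ 'n) \<times> (real ^ 'n)\<close>; the kernel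
  has the value 0 on the diagonal (division by zero), which is a null set.
\<close>

definition crit_exp :: "nat \<Rightarrow> real \<Rightarrow> real \<Rightarrow> real" where
  "crit_exp N s p = real N * p / (real N - s * p)"

definition gagliardo_density :: "real \<Rightarrow> real \<Rightarrow> (real ^ 'n::finite \<Rightarrow> real)
    \<Rightarrow> (real ^ 'n) \<times> (real ^ 'n) \<Rightarrow> real" where
  "gagliardo_density s p u =
     (\<lambda>(x, y). \<bar>u x - u y\<bar> powr p / norm (x - y) powr (real CARD('n) + s * p))"

definition hom_sobolev :: "real \<Rightarrow> real \<Rightarrow> (real ^ 'n::finite \<Rightarrow> real) set" where
  "hom_sobolev s p = {u. u \<in> borel_measurable lebesgue
      \<and> integrable lebesgue (\<lambda>x. \<bar>u x\<bar> powr crit_exp CARD('n) s p)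
      \<and> integrable lebesgue (gagliardo_density s p u)}"

definition hom_sobolev_norm :: "real \<Rightarrow> real \<Rightarrow> (real ^ 'n::finite \<Rightarrow> real) \<Rightarrow> real" where
  "hom_sobolev_norm s p u = (LINT z|lebesgue. gagliardo_density s p u z) powr (1 / p)"

definition ae_zero :: "(real ^ 'n::finite \<Rightarrow> real) \<Rightarrow> bool" where
  "ae_zero u \<longleftrightarrow> (AE x in lebesgue. u x = 0)"

definition ae_pos :: "(real ^ 'n::finite \<Rightarrow> real) \<Rightarrow> bool" where
  "ae_pos u \<longleftrightarrow> (AE x in lebesgue. u x > 0)"

definition frac_p_laplacian :: "real \<Rightarrow> real \<Rightarrow> (real ^ 'n::finite \<Rightarrow> real)
    \<Rightarrow> (real ^ 'n \<Rightarrow> real) \<Rightarrow> real" where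
  "frac_p_laplacian s p u \<phi> =
     (LINT z|lebesgue. (case z of (x, y) \<Rightarrow>
        \<bar>u x - u y\<bar> powr (p - 2) * (u x - u y) * (\<phi> x - \<phi> y)
          / norm (x - y) powr (real CARD('n) + s * p)))"

text \<open>\<open>(-\<Delta>\<^sub>p)\<^sup>s u = f\<close> in \<open>\<real>\<^sup>N\<close>, tested against every \<open>\<phi>\<close> in the homogeneous space.\<close>

definition weak_eq :: "real \<Rightarrow> real \<Rightarrow> (real ^ 'n::finite \<Rightarrow> real) \<Rightarrow> (real ^ 'n \<Rightarrow> real) \<Rightarrow> bool" where
  "weak_eq s p u f \<longleftrightarrow>
     (\<forall>\<phi> \<in> hom_sobolev s p. frac_p_laplacian s p u \<phi> = (LINT x|lebesgue. f x * \<phi> x))"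

definition sobolev_quotient :: "real \<Rightarrow> real \<Rightarrow> (real ^ 'n::finite \<Rightarrow> real) \<Rightarrow> real" where
  "sobolev_quotient s p u = hom_sobolev_norm s p u powr p
     / (LINT x|lebesgue. \<bar>u x\<bar> powr crit_exp CARD('n) s p) powr (p / crit_exp CARD('n) s p)"

definition best_sobolev :: "'n::finite itself \<Rightarrow> real \<Rightarrow> real \<Rightarrow> real" where
  "best_sobolev _ s p =
     (INF u \<in> {u :: real ^ 'n \<Rightarrow> real. u \<in> hom_sobolev s p \<and> \<not> ae_zero u}. sobolev_quotient s p u)"

definition sobolev_minimizer :: "real \<Rightarrow> real \<Rightarrow> (real ^ 'n::finite \<Rightarrow> real) \<Rightarrow> bool" where
  "sobolev_minimizer s p U \<longleftrightarrow> U \<in> hom_sobolev s p \<and> \<not> ae_zero U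
     \<and> sobolev_quotient s p U = best_sobolev TYPE('n) s p"

definition normalized_minimizer :: "real \<Rightarrow> real \<Rightarrow> (real ^ 'n::finite \<Rightarrow> real) \<Rightarrow> bool" where
  "normalized_minimizer s p U \<longleftrightarrow> sobolev_minimizer s p U
     \<and> weak_eq s p U (\<lambda>x. U x powr (crit_exp CARD('n) s p - 1)) \<and> ae_pos U"

definition system_solution :: "real \<Rightarrow> real \<Rightarrow> real \<Rightarrow> real \<Rightarrow> real
    \<Rightarrow> (real ^ 'n::finite \<Rightarrow> real) \<Rightarrow> (real ^ 'n \<Rightarrow> real) \<Rightarrow> bool" where
  "system_solution s p \<alpha> \<beta> \<gamma> u v \<longleftrightarrow>
     u \<in> hom_sobolev s p \<and> v \<in> hom_sobolev s p
     \<and> weak_eq s p u (\<lambda>x. \<bar>u x\<bar> powr (crit_exp CARD('n) s p - 2) * u x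
          + \<alpha> * \<gamma> / crit_exp CARD('n) s p * \<bar>u x\<bar> powr (\<alpha> - 2) * u x * \<bar>v x\<bar> powr \<beta>)
     \<and> weak_eq s p v (\<lambda>x. \<bar>v x\<bar> powr (crit_exp CARD('n) s p - 2) * v x
          + \<beta> * \<gamma> / crit_exp CARD('n) s p * \<bar>v x\<bar> powr (\<beta> - 2) * v x * \<bar>u x\<bar> powr \<alpha>)"

definition positive_system_solution :: "real \<Rightarrow> real \<Rightarrow> real \<Rightarrow> real \<Rightarrow> real
    \<Rightarrow> (real ^ 'n::finite \<Rightarrow> real) \<Rightarrow> (real ^ 'n \<Rightarrow> real) \<Rightarrow> bool" where
  "positive_system_solution s p \<alpha> \<beta> \<gamma> u v \<longleftrightarrow>
     system_solution s p \<alpha> \<beta> \<gamma> u v \<and> ae_pos u \<and> ae_pos v"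

definition coupling :: "real \<Rightarrow> real \<Rightarrow> real \<Rightarrow> real \<Rightarrow> real
    \<Rightarrow> (real ^ 'n::finite \<Rightarrow> real) \<Rightarrow> (real ^ 'n \<Rightarrow> real) \<Rightarrow> real" where
  "coupling s p \<alpha> \<beta> \<gamma> u v =
     (LINT x|lebesgue. \<bar>u x\<bar> powr crit_exp CARD('n) s p + \<bar>v x\<bar> powr crit_exp CARD('n) s p
        + \<gamma> * \<bar>u x\<bar> powr \<alpha> * \<bar>v x\<bar> powr \<beta>)"

definition energy :: "real \<Rightarrow> real \<Rightarrow> real \<Rightarrow> real \<Rightarrow> real
    \<Rightarrow> (real ^ 'n::finite \<Rightarrow> real) \<Rightarrow> (real ^ 'n \<Rightarrow> real) \<Rightarrow> real" where
  "energy s p \<alpha> \<beta> \<gamma> u v =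
     1 / p * (hom_sobolev_norm s p u powr p + hom_sobolev_norm s p v powr p)
     - 1 / crit_exp CARD('n) s p * coupling s p \<alpha> \<beta> \<gamma> u v"

definition nehari :: "real \<Rightarrow> real \<Rightarrow> real \<Rightarrow> real \<Rightarrow> real
    \<Rightarrow> ((real ^ 'n::finite \<Rightarrow> real) \<times> (real ^ 'n \<Rightarrow> real)) set" where
  "nehari s p \<alpha> \<beta> \<gamma> = {(u, v). u \<in> hom_sobolev s p \<and> v \<in> hom_sobolev s p
     \<and> \<not> (ae_zero u \<and> ae_zero v)
     \<and> hom_sobolev_norm s p u powr p + hom_sobolev_norm s p v powr p = coupling s p \<alpha> \<beta> \<gamma> u v}"

definition nehari_level :: "'n::finite itself \<Rightarrow> real \<Rightarrow> real \<Rightarrow> real \<Rightarrow> real \<Rightarrow> real \<Rightarrow> real" where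
  "nehari_level _ s p \<alpha> \<beta> \<gamma> =
     (INF (u, v) \<in> (nehari s p \<alpha> \<beta> \<gamma> :: ((real ^ 'n \<Rightarrow> real) \<times> (real ^ 'n \<Rightarrow> real)) set).
        energy s p \<alpha> \<beta> \<gamma> u v)"

definition algebraic_system :: "real \<Rightarrow> real \<Rightarrow> real \<Rightarrow> real \<Rightarrow> real \<Rightarrow> real \<Rightarrow> real \<Rightarrow> bool" where
  "algebraic_system ps p \<alpha> \<beta> \<gamma> k l \<longleftrightarrow>
     k powr ((ps - p) / p) + \<alpha> * \<gamma> / ps * k powr ((\<alpha> - p) / p) * l powr (\<beta> / p) = 1
     \<and> l powr ((ps - p) / p) + \<beta> * \<gamma> / ps * l powr ((\<beta> - p) / p) * k powr (\<alpha> / p) = 1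
     \<and> k > 0 \<and> l > 0"

end

theory Submission
  imports Defs
begin

text \<open>
  For \<open>\<gamma> = 0\<close> the algebraic system has the solution \<open>(1, 1)\<close>. For small \<open>\<gamma> > 0\<close>, solving each equation
  for its leading power gives a continuous self-map of \<open>[3/4, 1]\<^sup>2\<close>, and Brouwer's theorem yields a
  solution there; in particular \<open>k + l > 1\<close>. By homogeneity the rescaled pair solves the
  system and has energy \<open>(1/p - 1/p\<^sub>s\<^sup>*) (k + l) \<parallel>U\<parallel>\<^sup>p\<close>, whereas the semitrivial pair \<open>(U, 0)\<close> lies on
  the Nehari set with energy \<open>(1/p - 1/p\<^sub>s\<^sup>*) \<parallel>U\<parallel>\<^sup>p\<close>, which is smaller.
\<close>

section \<open>Solving the algebraic system for weak coupling\<close>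

lemma algebraic_system_solvable:
  fixes ps p \<alpha> \<beta> :: real
  assumes p: "0 < p" "p < ps" and \<alpha>: "0 < \<alpha>" and \<beta>: "0 < \<beta>"
    and \<alpha>p: "\<alpha> \<le> p" and \<beta>p: "\<beta> \<le> p"
  shows "\<exists>\<gamma>\<^sub>1>0. \<forall>\<gamma>\<in>{0<..<\<gamma>\<^sub>1}. \<exists>k l. algebraic_system ps p \<alpha> \<beta> \<gamma> k l \<and> k + l > 1"
proof -
  define q where "q = (ps - p) / p"
  have q: "q > 0" using p by (simp add: q_def)
  \<comment> \<open>Any value strictly between 1/2 and 1 serves: above 1/2 it forces
    \<open>k + l > 1\<close> on the square, below 1 it leaves room for the perturbation of the
    solution \<open>(1, 1)\<close>.\<close>
  define a :: real where "a = 3/4"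
  have a: "0 < a" "a < 1" by (auto simp: a_def)
  \<comment> \<open>\<open>\<delta>\<close> is the amount a coupling term may subtract from 1 before
    the leading power drops below \<open>a powr q\<close>.\<close>
  define \<delta> where "\<delta> = 1 - a powr q"
  have \<delta>: "0 < \<delta>" using a q powr_less_mono2[of q a 1] by (simp add: \<delta>_def)
  \<comment> \<open>\<open>M\<close> bounds both coupling terms, divided by \<open>\<gamma>\<close>,
    on the square: the exponents \<open>(\<alpha> - p) / p\<close> and
    \<open>(\<beta> - p) / p\<close> are nonpositive, so these powers are largest at
    \<open>a\<close>, and the other factor is at most 1. Hence \<open>\<delta> / M\<close> can serve
    as the threshold for \<open>\<gamma>\<close>.\<close>
  define M where "M = max (\<alpha> / ps * a powr ((\<alpha> - p) / p)) (\<beta> / ps * a powr ((\<beta> - p) / p))"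
  have M: "M > 0" using assms a by (auto simp: M_def less_max_iff_disj)
  \<comment> \<open>The generic exponents \<open>e\<close> and \<open>f\<close> let one estimate
    cover both equations, with \<open>\<alpha>\<close>, \<open>\<beta>\<close> and the two variables
    exchanged.\<close>
  have step: "a powr q \<le> 1 - e * \<gamma> / ps * x powr ((e - p) / p) * y powr (f / p) \<and>
      1 - e * \<gamma> / ps * x powr ((e - p) / p) * y powr (f / p) \<le> 1"
    if g: "0 < \<gamma>" "\<gamma> < \<delta> / M" and x: "a \<le> x" "x \<le> 1" and y: "a \<le> y" "y \<le> 1"
      and e: "0 < e" "e \<le> p" and f: "0 < f"
      and eM: "e / ps * a powr ((e - p) / p) \<le> M" for \<gamma> x y e f
  proof -
    have "x powr ((e - p) / p) \<le> a powr ((e - p) / p)"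
      using e x a p by (intro powr_mono2') (auto simp: divide_nonpos_pos)
    moreover have "y powr (f / p) \<le> 1"
      using f y a p by (intro powr_le1) auto
    ultimately have "x powr ((e - p) / p) * y powr (f / p) \<le> a powr ((e - p) / p) * 1"
      by (intro mult_mono) auto
    then have "e * \<gamma> / ps * (x powr ((e - p) / p) * y powr (f / p)) \<le> e * \<gamma> / ps * a powr ((e - p) / p)"
      using e g p by (intro mult_left_mono) auto
    also have "\<dots> = \<gamma> * (e / ps * a powr ((e - p) / p))" by simp
    also have "\<dots> \<le> \<gamma> * M" using eM g by (intro mult_left_mono) auto
    also have "\<dots> \<le> \<delta>" using g M by (simp add: field_simps)
    finally have "e * \<gamma> / ps * x powr ((e - p) / p) * y powr (f / p) \<le> \<delta>" by (simp add: mult_ac)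
    moreover have "0 \<le> e * \<gamma> / ps * x powr ((e - p) / p) * y powr (f / p)"
      using e g p by (intro mult_nonneg_nonneg divide_nonneg_nonneg) auto
    ultimately show ?thesis by (auto simp: \<delta>_def)
  qed
  have root: "a \<le> r powr (1 / q) \<and> r powr (1 / q) \<le> 1" if "a powr q \<le> r" "r \<le> 1" for r
  proof -
    have "(a powr q) powr (1 / q) \<le> r powr (1 / q)"
      using that q by (intro powr_mono2) auto
    moreover have "r powr (1 / q) \<le> 1"
      using that q order_trans[OF powr_ge_zero that(1)] by (intro powr_le1) auto
    ultimately show ?thesis using a q by (simp add: powr_powr)
  qed
  show ?thesis
  proof (rule exI[of _ "\<delta> / M"], intro conjI ballI)
    show "0 < \<delta> / M" using \<delta> M by simp
    fix \<gamma> assume g: "\<gamma> \<in> {0<..<\<delta> / M}"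
    \<comment> \<open>With \<open>z = (k, l)\<close>, \<open>A\<close> and \<open>B\<close> are the
      values that the two equations prescribe for \<open>k powr q\<close> and
      \<open>l powr q\<close>; a fixed point of their \<open>q\<close>-th roots is a
      solution.\<close>
    define A where "A z = 1 - \<alpha> * \<gamma> / ps * fst z powr ((\<alpha> - p) / p) * snd z powr (\<beta> / p)" for z :: "real \<times> real"
    define B where "B z = 1 - \<beta> * \<gamma> / ps * snd z powr ((\<beta> - p) / p) * fst z powr (\<alpha> / p)" for z :: "real \<times> real"
    define Q where "Q = cbox (a, a) (1, 1 :: real)"
    have Q: "z \<in> Q \<longleftrightarrow> a \<le> fst z \<and> fst z \<le> 1 \<and> a \<le> snd z \<and> snd z \<le> 1" for z
      unfolding Q_def by (cases z) (auto simp: cbox_Pair_eq)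
    have A: "a powr q \<le> A z \<and> A z \<le> 1" if "z \<in> Q" for z
      unfolding A_def using that g \<alpha> \<beta> \<alpha>p \<beta>p by (intro step) (auto simp: Q M_def)
    have B: "a powr q \<le> B z \<and> B z \<le> 1" if "z \<in> Q" for z
      unfolding B_def using that g \<alpha> \<beta> \<alpha>p \<beta>p by (intro step) (auto simp: Q M_def)
    \<comment> \<open>Strict positivity keeps the roots continuous and lets the power
      \<open>q\<close> undo them at the fixed point.\<close>
    have pos: "0 < A z" "0 < B z" if "z \<in> Q" for z
      using A[OF that] B[OF that] a powr_gt_zero[of a q] by linarith+
    have nz: "z \<in> Q \<Longrightarrow> fst z \<noteq> 0" "z \<in> Q \<Longrightarrow> snd z \<noteq> 0" for z
      using a by (auto simp: Q)
    have "continuous_on Q A" "continuous_on Q B"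
      unfolding A_def B_def using nz p by (auto intro!: continuous_intros)
    then have cont: "continuous_on Q (\<lambda>z. (A z powr (1 / q), B z powr (1 / q)))"
      using pos by (intro continuous_intros ballI) (auto simp: less_imp_neq[THEN not_sym])
    have "compact Q" "convex Q" unfolding Q_def by auto
    moreover have "Q \<noteq> {}" using a Q[of "(1, 1)"] by auto
    moreover have "(\<lambda>z. (A z powr (1 / q), B z powr (1 / q))) \<in> Q \<rightarrow> Q"
      using root A B by (auto simp: Q)
    ultimately obtain z where z: "z \<in> Q" "(A z powr (1 / q), B z powr (1 / q)) = z"
      by (rule brouwer[OF _ _ _ cont])
    then have "fst z = A z powr (1 / q)" "snd z = B z powr (1 / q)"
      by (metis fst_conv, metis snd_conv)
    then have "fst z powr q = A z" "snd z powr q = B z"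
      using pos[OF z(1)] q by (simp_all only: powr_powr) simp_all
    then have "algebraic_system ps p \<alpha> \<beta> \<gamma> (fst z) (snd z)"
      using z(1) a by (auto simp: algebraic_system_def A_def B_def Q q_def)
    moreover have "fst z + snd z > 1" using z(1) by (auto simp: Q a_def)
    ultimately show "\<exists>k l. algebraic_system ps p \<alpha> \<beta> \<gamma> k l \<and> k + l > 1" by blast
  qed
qed

section \<open>Scaling laws for the norm, the operator and the coupling\<close>

text \<open>At \<open>t = 0\<close> both sides vanish because \<open>0 powr r = 0\<close> for every
  \<open>r\<close>, so the identity needs no case distinction on the diagonal or where differences
  vanish.\<close>

lemma abs_powr_minus_two_mult: "\<bar>t\<bar> powr (r - 2) * t * t = \<bar>t\<bar> powr r" for t r :: real
proof -
  have "\<bar>t\<bar> powr (r - 2) * t * t = \<bar>t\<bar> * (\<bar>t\<bar> * \<bar>t\<bar> powr (r - 2))" by simp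
  then show ?thesis by (simp only: powr_mult_base abs_ge_zero) simp
qed

lemma powr_minus_two_mult: "0 < t \<Longrightarrow> t powr (r - 2) * t = t powr (r - 1)" for t r :: real
  by (simp add: powr_mult_base mult.commute)

text \<open>The exponents \<open>1 / p\<close> and \<open>p\<close> cancel since the Gagliardo
  integral is nonnegative; a Bochner integral of a non-integrable function is 0, which is consistent
  with this.\<close>

lemma hom_sobolev_norm_powr:
  assumes "p \<noteq> 0"
  shows "hom_sobolev_norm s p u powr p = (LINT z|lebesgue. gagliardo_density s p u z)"
proof -
  have "0 \<le> (LINT z|lebesgue. gagliardo_density s p u z)"
    by (intro integral_nonneg_AE AE_I2) (auto simp: gagliardo_density_def split_beta)
  then show ?thesis using assms by (simp add: hom_sobolev_norm_def powr_powr)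
qed

lemma gagliardo_density_scale:
  assumes "0 \<le> c"
  shows "gagliardo_density s p (\<lambda>x. c * u x) z = c powr p * gagliardo_density s p u z"
proof -
  have "\<bar>c * u x - c * u y\<bar> = c * \<bar>u x - u y\<bar>" for x y
    using assms by (simp add: abs_mult flip: right_diff_distrib)
  then show ?thesis using assms by (simp add: gagliardo_density_def split_beta powr_mult)
qed

lemma hom_sobolev_scale:
  assumes "u \<in> hom_sobolev s p" "0 \<le> c"
  shows "(\<lambda>x. c * u x) \<in> hom_sobolev s p"
proof -
  have "gagliardo_density s p (\<lambda>x. c * u x) = (\<lambda>z. c powr p * gagliardo_density s p u z)"
    using assms by (simp add: fun_eq_iff gagliardo_density_scale)
  then show ?thesis using assms by (auto simp: hom_sobolev_def abs_mult powr_mult intro!: borel_measurable_times)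
qed

lemma hom_sobolev_zero: "(\<lambda>x. 0) \<in> hom_sobolev s p"
  by (simp add: hom_sobolev_def gagliardo_density_def split_def)

lemma hom_sobolev_norm_scale_powr:
  assumes "p \<noteq> 0" "0 \<le> c"
  shows "hom_sobolev_norm s p (\<lambda>x. c * u x) powr p = c powr p * hom_sobolev_norm s p u powr p"
  using assms by (simp add: hom_sobolev_norm_powr gagliardo_density_scale)

lemma hom_sobolev_norm_zero: "hom_sobolev_norm s p (\<lambda>x. 0) = 0"
  by (simp add: hom_sobolev_norm_def gagliardo_density_def split_def)

text \<open>Testing with \<open>u\<close> itself turns the integrand into the Gagliardo density;
  this links the weak equation to the energy.\<close>

lemma frac_p_laplacian_self:
  assumes "p \<noteq> 0"
  shows "frac_p_laplacian s p u u = hom_sobolev_norm s p u powr p"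
  by (simp add: assms hom_sobolev_norm_powr frac_p_laplacian_def gagliardo_density_def
      abs_powr_minus_two_mult)

text \<open>The integrand is positively homogeneous of degree \<open>p - 1\<close> in
  \<open>u\<close>, and a constant factor always leaves a Bochner integral.\<close>

lemma frac_p_laplacian_scale:
  assumes "0 < c"
  shows "frac_p_laplacian s p (\<lambda>x. c * u x) \<phi> = c powr (p - 1) * frac_p_laplacian s p u \<phi>"
proof -
  have "\<bar>c * u x - c * u y\<bar> powr (p - 2) * (c * u x - c * u y)
      = c powr (p - 1) * (\<bar>u x - u y\<bar> powr (p - 2) * (u x - u y))" for x y
  proof -
    have "\<bar>c * u x - c * u y\<bar> = c * \<bar>u x - u y\<bar>"
      using assms by (simp add: abs_mult flip: right_diff_distrib)
    then have "\<bar>c * u x - c * u y\<bar> powr (p - 2) * (c * u x - c * u y)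
        = (c powr (p - 2) * c) * (\<bar>u x - u y\<bar> powr (p - 2) * (u x - u y))"
      using assms by (simp add: powr_mult algebra_simps)
    then show ?thesis using assms by (simp only: powr_minus_two_mult)
  qed
  then have "frac_p_laplacian s p (\<lambda>x. c * u x) \<phi> = (LINT z|lebesgue. c powr (p - 1) *
      (case z of (x, y) \<Rightarrow> \<bar>u x - u y\<bar> powr (p - 2) * (u x - u y) * (\<phi> x - \<phi> y)
          / norm (x - y) powr (real CARD('a) + s * p)))"
    unfolding frac_p_laplacian_def
    by (intro Bochner_Integration.integral_cong) (auto simp: mult.assoc)
  then show ?thesis by (simp add: frac_p_laplacian_def)
qed

lemma hom_sobolev_measurable: "u \<in> hom_sobolev s p \<Longrightarrow> u \<in> borel_measurable lebesgue"
  by (simp add: hom_sobolev_def)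

text \<open>Because \<open>e + f = q\<close>, every term on the right is a multiple of
  \<open>U powr (q - 1)\<close>, as is the scaled equation for \<open>U\<close>;
  \<open>coeff\<close> says that the two multiples agree. Exchanging \<open>a\<close> with
  \<open>b\<close> and \<open>e\<close> with \<open>f\<close> yields the other equation of the
  system.\<close>

lemma weak_eq_scale:
  fixes U :: "real ^ 'n::finite \<Rightarrow> real"
  assumes U: "U \<in> hom_sobolev s p" "ae_pos U"
    and eq: "weak_eq s p U (\<lambda>x. U x powr (q - 1))"
    and a: "0 < a" and b: "0 < b" and sum: "e + f = q"
    and coeff: "a powr (q - 1) + c * a powr (e - 1) * b powr f = a powr (p - 1)"
  shows "weak_eq s p (\<lambda>x. a * U x) (\<lambda>x. \<bar>a * U x\<bar> powr (q - 2) * (a * U x)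
          + c * \<bar>a * U x\<bar> powr (e - 2) * (a * U x) * \<bar>b * U x\<bar> powr f)"
  unfolding weak_eq_def
proof
  fix \<phi> :: "real ^ 'n \<Rightarrow> real" assume \<phi>: "\<phi> \<in> hom_sobolev s p"
  note [measurable] = hom_sobolev_measurable[OF U(1)] hom_sobolev_measurable[OF \<phi>]
  have pointwise: "\<bar>a * t\<bar> powr (q - 2) * (a * t) + c * \<bar>a * t\<bar> powr (e - 2) * (a * t) * \<bar>b * t\<bar> powr f
      = a powr (p - 1) * t powr (q - 1)" if "0 < t" for t
  proof -
    have "t powr (e - 1) * t powr f = t powr (q - 1)"
      using that sum by (simp add: algebra_simps flip: powr_add)
    then have "a powr (q - 1) * t powr (q - 1) + c * (a powr (e - 1) * t powr (e - 1)) * (b powr f * t powr f)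
        = (a powr (q - 1) + c * a powr (e - 1) * b powr f) * t powr (q - 1)"
      by (simp add: algebra_simps)
    moreover have "\<bar>a * t\<bar> powr (r - 2) * (a * t) = a powr (r - 1) * t powr (r - 1)" for r
      using a that powr_minus_two_mult[of "a * t" r] by (simp add: powr_mult)
    moreover have "\<bar>b * t\<bar> powr f = b powr f * t powr f"
      using b that by (simp add: powr_mult)
    ultimately show ?thesis
      by (simp only: coeff[unfolded mult.assoc] mult.assoc)
  qed
  have "frac_p_laplacian s p (\<lambda>x. a * U x) \<phi> = (LINT x|lebesgue. a powr (p - 1) * (U x powr (q - 1) * \<phi> x))"
    using eq \<phi> a by (simp add: frac_p_laplacian_scale weak_eq_def)
  \<comment> \<open>\<open>U\<close> is positive only almost everywhere, so the integrands agree
    only almost everywhere; the comparison then requires both to be measurable.\<close>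
  also have "\<dots> = (LINT x|lebesgue. (\<bar>a * U x\<bar> powr (q - 2) * (a * U x)
          + c * \<bar>a * U x\<bar> powr (e - 2) * (a * U x) * \<bar>b * U x\<bar> powr f) * \<phi> x)"
  proof (rule integral_cong_AE)
    show "AE x in lebesgue. a powr (p - 1) * (U x powr (q - 1) * \<phi> x) = (\<bar>a * U x\<bar> powr (q - 2) * (a * U x)
          + c * \<bar>a * U x\<bar> powr (e - 2) * (a * U x) * \<bar>b * U x\<bar> powr f) * \<phi> x"
      using U(2) unfolding ae_pos_def by eventually_elim (simp only: pointwise mult.assoc[of _ _ "\<phi> _"])
  qed measurable
  finally show "frac_p_laplacian s p (\<lambda>x. a * U x) \<phi> = \<dots>" .
qed

lemma ae_pos_scale: "ae_pos U \<Longrightarrow> 0 < c \<Longrightarrow> ae_pos (\<lambda>x. c * U x)"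
  unfolding ae_pos_def by (elim eventually_mono) simp

text \<open>As \<open>\<alpha> + \<beta>\<close> is the critical exponent, the mixed term is a
  multiple of the same power of \<open>\<bar>U x\<bar>\<close> as the two pure terms.\<close>

lemma coupling_scale:
  fixes U :: "real ^ 'n::finite \<Rightarrow> real"
  assumes "0 \<le> a" "0 \<le> b" "\<alpha> + \<beta> = crit_exp CARD('n) s p"
  shows "coupling s p \<alpha> \<beta> \<gamma> (\<lambda>x. a * U x) (\<lambda>x. b * U x) =
    (a powr crit_exp CARD('n) s p + b powr crit_exp CARD('n) s p + \<gamma> * a powr \<alpha> * b powr \<beta>)
      * (LINT x|lebesgue. \<bar>U x\<bar> powr crit_exp CARD('n) s p)"
proof -
  have "\<bar>a * t\<bar> powr crit_exp CARD('n) s p + \<bar>b * t\<bar> powr crit_exp CARD('n) s p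
        + \<gamma> * \<bar>a * t\<bar> powr \<alpha> * \<bar>b * t\<bar> powr \<beta>
      = (a powr crit_exp CARD('n) s p + b powr crit_exp CARD('n) s p + \<gamma> * a powr \<alpha> * b powr \<beta>)
        * \<bar>t\<bar> powr crit_exp CARD('n) s p" for t
    using assms(1,2) by (simp add: abs_mult powr_mult algebra_simps powr_add flip: assms(3))
  then show ?thesis by (simp add: coupling_def)
qed

section \<open>The Nehari level and the integral of the minimizer\<close>

text \<open>A real infimum lies below its members only if the set is bounded below. On the Nehari
  set the energy is \<open>1 / p - 1 / crit_exp CARD('n) s p\<close>, a nonnegative factor, times
  the sum of the norm powers, so 0 is a lower bound.\<close>

lemma nehari_level_le_energy:
  fixes u v :: "real ^ 'n::finite \<Rightarrow> real"
  assumes "0 < p" "p \<le> crit_exp CARD('n) s p" "(u, v) \<in> nehari s p \<alpha> \<beta> \<gamma>"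
  shows "nehari_level TYPE('n) s p \<alpha> \<beta> \<gamma> \<le> energy s p \<alpha> \<beta> \<gamma> u v"
proof -
  have "0 \<le> energy s p \<alpha> \<beta> \<gamma> u v" if "(u, v) \<in> nehari s p \<alpha> \<beta> \<gamma>" for u v :: "real ^ 'n \<Rightarrow> real"
  proof -
    have "energy s p \<alpha> \<beta> \<gamma> u v = (1 / p - 1 / crit_exp CARD('n) s p) *
        (hom_sobolev_norm s p u powr p + hom_sobolev_norm s p v powr p)"
      using that by (simp add: energy_def nehari_def left_diff_distrib)
    then show ?thesis using assms(1,2) by (simp add: frac_le)
  qed
  then have "bdd_below ((\<lambda>(u, v). energy s p \<alpha> \<beta> \<gamma> u v) `
      (nehari s p \<alpha> \<beta> \<gamma> :: ((real ^ 'n \<Rightarrow> real) \<times> (real ^ 'n \<Rightarrow> real)) set))"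
    by (intro bdd_belowI2[where m = 0]) auto
  from cINF_lower[OF this assms(3)] show ?thesis by (simp add: nehari_level_def)
qed

text \<open>The equation for \<open>U\<close> is tested with \<open>U\<close> itself; the common
  value is positive because \<open>U\<close> is not zero almost everywhere.\<close>

lemma normalized_minimizer_integral:
  fixes U :: "real ^ 'n::finite \<Rightarrow> real"
  assumes "p \<noteq> 0" "normalized_minimizer s p U"
  shows "hom_sobolev_norm s p U powr p = (LINT x|lebesgue. \<bar>U x\<bar> powr crit_exp CARD('n) s p)"
    and "0 < (LINT x|lebesgue. \<bar>U x\<bar> powr crit_exp CARD('n) s p)"
proof -
  define q where "q = crit_exp CARD('n) s p"
  have U: "U \<in> hom_sobolev s p" "\<not> ae_zero U" "ae_pos U" "weak_eq s p U (\<lambda>x. U x powr (q - 1))"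
    using assms(2) by (auto simp: normalized_minimizer_def sobolev_minimizer_def q_def)
  note [measurable] = hom_sobolev_measurable[OF U(1)]
  have "hom_sobolev_norm s p U powr p = (LINT x|lebesgue. U x powr (q - 1) * U x)"
    using U(1,4) assms(1) by (simp add: weak_eq_def flip: frac_p_laplacian_self)
  also have "\<dots> = (LINT x|lebesgue. \<bar>U x\<bar> powr q)"
  proof (rule integral_cong_AE)
    show "AE x in lebesgue. U x powr (q - 1) * U x = \<bar>U x\<bar> powr q"
      using U(3) unfolding ae_pos_def by eventually_elim (simp add: powr_mult_base mult.commute)
  qed measurable
  finally show "hom_sobolev_norm s p U powr p = (LINT x|lebesgue. \<bar>U x\<bar> powr crit_exp CARD('n) s p)"
    by (simp add: q_def)
  have int: "integrable lebesgue (\<lambda>x. \<bar>U x\<bar> powr crit_exp CARD('n) s p)"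
    using U(1) by (simp add: hom_sobolev_def)
  have "(LINT x|lebesgue. \<bar>U x\<bar> powr crit_exp CARD('n) s p) \<noteq> 0"
    using U(2) integral_nonneg_eq_0_iff_AE[OF int] by (simp add: ae_zero_def)
  then show "0 < (LINT x|lebesgue. \<bar>U x\<bar> powr crit_exp CARD('n) s p)"
    by (simp add: order_less_le)
qed

section \<open>The synchronized solution and its energy\<close>

theorem theorem1p6:
  fixes s p \<alpha> \<beta> :: real
  assumes "0 < s" and "s < 1" and "1 < p" and "real CARD('n::finite) > s * p"
    and "\<alpha> > 1" and "\<beta> > 1" and "\<alpha> + \<beta> = crit_exp CARD('n) s p"
    and "2 * real CARD('n) / (real CARD('n) + 2 * s) < p" and "p < real CARD('n) / (2 * s)"
    and "\<alpha> < p" and "\<beta> < p"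
  shows "\<exists>\<gamma>\<^sub>1 > 0. \<forall>\<gamma> \<in> {0<..<\<gamma>\<^sub>1}. \<exists>k l.
    algebraic_system (crit_exp CARD('n) s p) p \<alpha> \<beta> \<gamma> k l \<and>
    (\<forall>U :: real ^ 'n \<Rightarrow> real. normalized_minimizer s p U \<longrightarrow>
       positive_system_solution s p \<alpha> \<beta> \<gamma>
         (\<lambda>x. k powr (1 / p) * U x) (\<lambda>x. l powr (1 / p) * U x) \<and>
       energy s p \<alpha> \<beta> \<gamma>
         (\<lambda>x. k powr (1 / p) * U x) (\<lambda>x. l powr (1 / p) * U x) > nehari_level TYPE('n) s p \<alpha> \<beta> \<gamma>)"
proof -
  define q where "q = crit_exp CARD('n) s p"
  have q: "p < q" using assms(1,3,4) by (simp add: q_def crit_exp_def field_simps)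
  obtain \<gamma>\<^sub>1 where \<gamma>\<^sub>1: "\<gamma>\<^sub>1 > 0"
      "\<And>\<gamma>. \<gamma> \<in> {0<..<\<gamma>\<^sub>1} \<Longrightarrow> \<exists>k l. algebraic_system q p \<alpha> \<beta> \<gamma> k l \<and> k + l > 1"
    using algebraic_system_solvable[of p q \<alpha> \<beta>] assms q by auto
  \<comment> \<open>Here \<open>k\<close> and \<open>l\<close> come from the algebraic system alone,
    so the same pair works for every normalized minimizer \<open>U\<close>.\<close>
  have claim: "positive_system_solution s p \<alpha> \<beta> \<gamma> (\<lambda>x. k powr (1 / p) * U x) (\<lambda>x. l powr (1 / p) * U x) \<and>
      energy s p \<alpha> \<beta> \<gamma> (\<lambda>x. k powr (1 / p) * U x) (\<lambda>x. l powr (1 / p) * U x) > nehari_level TYPE('n) s p \<alpha> \<beta> \<gamma>"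
    if sys: "algebraic_system q p \<alpha> \<beta> \<gamma> k l" and kl: "k + l > 1" and U: "normalized_minimizer s p U"
    for \<gamma> k l and U :: "real ^ 'n \<Rightarrow> real"
  proof
    define a b where "a = k powr (1 / p)" and "b = l powr (1 / p)"
    have kl0: "k > 0" "l > 0" using sys by (auto simp: algebraic_system_def)
    then have ab: "a > 0" "b > 0" by (auto simp: a_def b_def)
    have apow: "k powr (r / p) = a powr r" "l powr (r / p) = b powr r" for r
      by (auto simp: a_def b_def powr_powr)
    have eqs: "a powr (q - p) + \<alpha> * \<gamma> / q * a powr (\<alpha> - p) * b powr \<beta> = 1"
      "b powr (q - p) + \<beta> * \<gamma> / q * b powr (\<beta> - p) * a powr \<alpha> = 1"
      using sys by (auto simp: algebraic_system_def apow)
    \<comment> \<open>Multiplying an equation by \<open>x powr r\<close>: \<open>r = p - 1\<close>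
      produces the coefficient condition of \<open>weak_eq_scale\<close>, and \<open>r = p\<close>
      produces the values \<open>k\<close> and \<open>l\<close> for the energy.\<close>
    have shift: "x powr (q - p + r) + c * x powr (e - p + r) * y = x powr r"
      if "x powr (q - p) + c * x powr (e - p) * y = 1" for x y c e r :: real
    proof -
      have "(x powr (q - p) + c * x powr (e - p) * y) * x powr r = x powr r" by (simp add: that)
      then show ?thesis by (simp only: powr_add distrib_left distrib_right mult_ac)
    qed
    have U': "U \<in> hom_sobolev s p" "\<not> ae_zero U" "ae_pos U" "weak_eq s p U (\<lambda>x. U x powr (q - 1))"
      using U by (auto simp: normalized_minimizer_def sobolev_minimizer_def q_def)
    have "weak_eq s p (\<lambda>x. a * U x) (\<lambda>x. \<bar>a * U x\<bar> powr (q - 2) * (a * U x)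
          + \<alpha> * \<gamma> / q * \<bar>a * U x\<bar> powr (\<alpha> - 2) * (a * U x) * \<bar>b * U x\<bar> powr \<beta>)"
      using shift[OF eqs(1), of "p - 1"] assms ab U' by (intro weak_eq_scale) (auto simp: q_def)
    moreover have "weak_eq s p (\<lambda>x. b * U x) (\<lambda>x. \<bar>b * U x\<bar> powr (q - 2) * (b * U x)
          + \<beta> * \<gamma> / q * \<bar>b * U x\<bar> powr (\<beta> - 2) * (b * U x) * \<bar>a * U x\<bar> powr \<alpha>)"
      using shift[OF eqs(2), of "p - 1"] assms ab U' by (intro weak_eq_scale) (auto simp: q_def)
    ultimately show "positive_system_solution s p \<alpha> \<beta> \<gamma> (\<lambda>x. k powr (1 / p) * U x) (\<lambda>x. l powr (1 / p) * U x)"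
      using ab U' by (auto simp: positive_system_solution_def system_solution_def hom_sobolev_scale
          ae_pos_scale q_def simp flip: a_def b_def)
    define I where "I = (LINT x|lebesgue. \<bar>U x\<bar> powr q)"
    have I: "hom_sobolev_norm s p U powr p = I" "0 < I"
      using normalized_minimizer_integral[OF _ U] assms(3) by (auto simp: I_def q_def)
    have "a powr p = k" "b powr p = l" using kl0 assms(3) by (auto simp: a_def b_def powr_powr)
    then have N: "hom_sobolev_norm s p (\<lambda>x. a * U x) powr p + hom_sobolev_norm s p (\<lambda>x. b * U x) powr p = (k + l) * I"
      using ab assms(3) by (simp add: hom_sobolev_norm_scale_powr I algebra_simps)
    have "a powr q + \<alpha> * \<gamma> / q * a powr \<alpha> * b powr \<beta> = k" "b powr q + \<beta> * \<gamma> / q * b powr \<beta> * a powr \<alpha> = l"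
      using shift[OF eqs(1), of p] shift[OF eqs(2), of p] \<open>a powr p = k\<close> \<open>b powr p = l\<close> by auto
    \<comment> \<open>Since \<open>\<alpha> / q + \<beta> / q = 1\<close>, the two coupling terms
      add up to the mixed coefficient in \<open>coupling_scale\<close>, and the sum of the shifted
      equations is the whole coefficient.\<close>
    moreover have "\<gamma> * a powr \<alpha> * b powr \<beta> = \<alpha> * \<gamma> / q * a powr \<alpha> * b powr \<beta> + \<beta> * \<gamma> / q * b powr \<beta> * a powr \<alpha>"
    proof -
      have "\<alpha> / q + \<beta> / q = 1"
        using assms(3,7) q by (simp add: q_def flip: add_divide_distrib)
      then have "\<gamma> * a powr \<alpha> * b powr \<beta> = (\<alpha> / q + \<beta> / q) * (\<gamma> * a powr \<alpha> * b powr \<beta>)" by simp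
      then show ?thesis by (simp add: algebra_simps)
    qed
    ultimately have "a powr q + b powr q + \<gamma> * a powr \<alpha> * b powr \<beta> = k + l" by linarith
    then have "coupling s p \<alpha> \<beta> \<gamma> (\<lambda>x. a * U x) (\<lambda>x. b * U x) = (k + l) * I"
      using ab assms(7) by (simp add: coupling_scale I_def flip: q_def)
    with N have E: "energy s p \<alpha> \<beta> \<gamma> (\<lambda>x. a * U x) (\<lambda>x. b * U x) = (1 / p - 1 / q) * ((k + l) * I)"
      by (simp add: energy_def left_diff_distrib flip: q_def)
    \<comment> \<open>The mixed term vanishes with the second component, so this competitor's energy
      does not depend on \<open>\<gamma>\<close>.\<close>
    have C0: "coupling s p \<alpha> \<beta> \<gamma> U (\<lambda>x. 0) = I"
      using assms(5,6) by (simp add: coupling_def I_def q_def)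
    have "(U, \<lambda>x. 0) \<in> nehari s p \<alpha> \<beta> \<gamma>"
      using U'(1,2) I C0 by (simp add: nehari_def hom_sobolev_zero hom_sobolev_norm_zero)
    then have "nehari_level TYPE('n) s p \<alpha> \<beta> \<gamma> \<le> energy s p \<alpha> \<beta> \<gamma> U (\<lambda>x. 0)"
      using assms(3) q by (intro nehari_level_le_energy) (auto simp: q_def)
    also have "\<dots> = (1 / p - 1 / q) * (1 * I)"
      using I C0 by (simp add: energy_def hom_sobolev_norm_zero left_diff_distrib flip: q_def)
    \<comment> \<open>Strictness combines \<open>k + l > 1\<close>, \<open>0 < I\<close> and
      \<open>p < q\<close>.\<close>
    also have "\<dots> < (1 / p - 1 / q) * ((k + l) * I)"
      using kl I q assms(3) by (intro mult_strict_left_mono mult_strict_right_mono) (auto simp: frac_less2)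
    finally show "energy s p \<alpha> \<beta> \<gamma> (\<lambda>x. k powr (1 / p) * U x) (\<lambda>x. l powr (1 / p) * U x)
        > nehari_level TYPE('n) s p \<alpha> \<beta> \<gamma>"
      by (simp add: E flip: a_def b_def)
  qed
  show ?thesis
  proof (rule exI[of _ \<gamma>\<^sub>1], intro conjI ballI)
    fix \<gamma> assume "\<gamma> \<in> {0<..<\<gamma>\<^sub>1}"
    then obtain k l where "algebraic_system q p \<alpha> \<beta> \<gamma> k l" "k + l > 1" using \<gamma>\<^sub>1 by blast
    then show "\<exists>k l. algebraic_system (crit_exp CARD('n) s p) p \<alpha> \<beta> \<gamma> k l \<and>
      (\<forall>U :: real ^ 'n \<Rightarrow> real. normalized_minimizer s p U \<longrightarrow>
       positive_system_solution s p \<alpha> \<beta> \<gamma>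
         (\<lambda>x. k powr (1 / p) * U x) (\<lambda>x. l powr (1 / p) * U x) \<and>
       energy s p \<alpha> \<beta> \<gamma>
         (\<lambda>x. k powr (1 / p) * U x) (\<lambda>x. l powr (1 / p) * U x) > nehari_level TYPE('n) s p \<alpha> \<beta> \<gamma>)"
      using claim by (intro exI[of _ k] exI[of _ l]) (auto simp flip: q_def)
  qed (use \<gamma>\<^sub>1 in auto)
qed

end
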